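(* Let $(\Omega,\mathcal F,\mu)$ be a probability space, $\Gamma$ a difference operator on a class $\mathcal A$ of bounded measurable functions on $\Omega$, and assume that $\mu$ satisfies a $\Gamma\mathrm{-mLSI}(\rho)$ for some $\rho>0$. Assume that $h^2\in\mathcal A$ and $\Gamma(h^2)\le 2h\,\Gamma(h)$ for all positive functions $h\in\mathcal A$. Let $f,g\in\mathcal A$ be such that $\Gamma(f)\le g$ and $\Gamma(g)\le b$ for a constant $b>0$. Then for any $t\ge0$ $$\mu(f-\mathbb E_\mu f\ge t)\le\exp\Big(-\frac1{4\rho}\min\Big(\frac{t^2}{2\,\mathbb E_\mu g^2},\frac tb\Big)\Big).$$ If moreover $h^2\in\mathcal A$ and $\Gamma(h^2)\le2|h|\,\Gamma(h)$ for every $h\in\mathcal A$, then the same upper bound holds for $\mu(\mathbb E_\mu f-f\ge t)$ for any $t\ge 0$.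
   Context: An operator $\Gamma$ on a class $\mathcal A$ of bounded measurable functions on a probability space $(\Omega,\mathcal F,\mu)$ is called a difference operator if (1) for all $f\in\mathcal A$, $\Gamma(f)$ is a non-negative measurable function; (2) for all $f\in\mathcal A$, $a\ge0$, $b\in\mathbb R$ we have $af+b\in\mathcal A$ and $\Gamma(af+b)=a\Gamma(f)$. $\mathbb E_\mu$ denotes expectation with respect to $\mu$, and for $h\ge0$, $\mathrm{Ent}_\mu(h)=\mathbb E_\mu h\log h-\mathbb E_\mu h\,\log(\mathbb E_\mu h)$. $\mu$ satisfies a $\Gamma\mathrm{-mLSI}(\rho)$, $\rho>0$, if $\mathrm{Ent}_\mu(e^f)\le\frac\rho2\,\mathbb E_\mu\big(\Gamma(f)^2e^f\big)$ for all $f\in\mathcal A$. Convention: $s/0=+\infty$ for $s>0$ and $0/0=0$. *)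

theory Defs
  imports "HOL-Probability.Probability"
begin

text \<open>
  Functions on the underlying set of a measure space are total functions of which only the values
  on \<open>space M\<close> matter; every pointwise requirement is therefore relativised to \<open>space M\<close>.
\<close>

definition difference_operator ::
  "'a measure \<Rightarrow> ('a \<Rightarrow> real) set \<Rightarrow> (('a \<Rightarrow> real) \<Rightarrow> 'a \<Rightarrow> real) \<Rightarrow> bool" where
  "difference_operator M \<A> \<Gamma> \<longleftrightarrow>
     (\<forall>f\<in>\<A>. f \<in> borel_measurable M \<and> bounded (f ` space M)) \<and>
     (\<forall>f\<in>\<A>. \<Gamma> f \<in> borel_measurable M \<and> (\<forall>x\<in>space M. 0 \<le> \<Gamma> f x)) \<and>
     (\<forall>f\<in>\<A>. \<forall>a\<ge>0. \<forall>b. (\<lambda>x. a * f x + b) \<in> \<A> \<and>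
        (\<forall>x\<in>space M. \<Gamma> (\<lambda>x. a * f x + b) x = a * \<Gamma> f x))"

text \<open>
  Meaningful only if both \<open>h\<close> and \<open>h log h\<close> are integrable, e.g. for bounded measurable
  \<open>h \<ge> 0\<close>; the convention \<open>0 log 0 = 0\<close> is automatic.
\<close>

definition Ent :: "'a measure \<Rightarrow> ('a \<Rightarrow> real) \<Rightarrow> real" where
  "Ent M h = (\<integral>x. h x * ln (h x) \<partial>M) - (\<integral>x. h x \<partial>M) * ln (\<integral>x. h x \<partial>M)"

text \<open>
  Since \<open>\<Gamma> f\<close> need not be bounded, the right-hand side may be infinite, in which case the
  inequality is void. Hence the nonnegative integral; a Bochner integral would be \<open>0\<close> there.
  No information is lost on the left, the entropy of \<open>e^f\<close> being nonnegative by Jensen.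
\<close>

definition mLSI ::
  "'a measure \<Rightarrow> ('a \<Rightarrow> real) set \<Rightarrow> (('a \<Rightarrow> real) \<Rightarrow> 'a \<Rightarrow> real) \<Rightarrow> real \<Rightarrow> bool" where
  "mLSI M \<A> \<Gamma> \<rho> \<longleftrightarrow> 0 < \<rho> \<and>
     (\<forall>f\<in>\<A>. ennreal (Ent M (\<lambda>x. exp (f x)))
        \<le> ennreal (\<rho> / 2) * (\<integral>\<^sup>+x. ennreal ((\<Gamma> f x)\<^sup>2 * exp (f x)) \<partial>M))"

text \<open>
  The quotient is taken in \<^typ>\<open>ereal\<close>, where \<open>s / 0 = \<infinity>\<close> for \<open>s > 0\<close> and \<open>0 / 0 = 0\<close>.
  The minimum is finite because of its second argument.
\<close>

definition two_level_bound :: "real \<Rightarrow> real \<Rightarrow> real \<Rightarrow> real \<Rightarrow> real" where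
  "two_level_bound \<rho> v b t =
     exp (- (1 / (4 * \<rho>)) * real_of_ereal (min (ereal (t\<^sup>2) / ereal (2 * v)) (ereal (t / b))))"

lemma ereal_division_convention:
  "0 < s \<Longrightarrow> ereal s / ereal 0 = \<infinity>" "ereal 0 / ereal 0 = 0"
  by (simp_all add: divide_ereal_def)

end

theory Submission
  imports Defs
begin

text \<open>
  Write \<open>s = 1 / (4 \<rho> b\<^sup>2)\<close> and \<open>v = E g\<^sup>2\<close>. For a positive \<open>g\<close> we have \<open>\<Gamma> (g\<^sup>2) \<le> 2 b g\<close>, so
  Herbst's argument for \<open>g\<^sup>2\<close> yields \<open>ln E exp (s g\<^sup>2) \<le> 2 s v\<close>; a nonnegative \<open>g\<close> is reached as
  the limit of \<open>g + \<epsilon>\<close>. By the duality of entropy and exponential moments this bounds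
  \<open>E (g\<^sup>2 exp (l f))\<close> by \<open>Ent (exp (l f)) / s + 2 v E exp (l f)\<close>. For \<open>2 \<rho> b l \<le> 1\<close> the entropy can be
  absorbed into the left-hand side of the logarithmic Sobolev inequality, and a second use of
  Herbst's argument gives \<open>ln E exp (l (f - E f)) \<le> 2 \<rho> l\<^sup>2 v\<close>, whence Chernoff's bound.
\<close>

section \<open>An exponential estimate and the class of bounded measurable functions\<close>

text \<open>For negative \<open>y\<close> the product \<open>(1 + y + y\<^sup>2) * (1 - y)\<close>
  equals \<open>1 - y^3\<close>, which is at least \<open>1\<close>, and
  \<open>1 - y \<le> exp (- y)\<close>. The estimate controls the remainder in
  \<open>DERIV_mgf\<close>.\<close>

lemma exp_minus_affine_bounds:
  fixes y :: real
  assumes "\<bar>y\<bar> \<le> 1"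
  shows "\<bar>exp y - 1 - y\<bar> \<le> y\<^sup>2"
proof -
  have "exp y \<le> 1 + y + y\<^sup>2"
  proof (cases "0 \<le> y")
    case True
    then show ?thesis
      using exp_bound[of y] assms by simp
  next
    case False
    have "1 \<le> (1 + y + y\<^sup>2) * (1 - y)"
    proof -
      have "(1 + y + y\<^sup>2) * (1 - y) = 1 + y\<^sup>2 * (- y)"
        by (simp add: power2_eq_square algebra_simps)
      then show ?thesis
        using False by (simp add: mult_nonneg_nonpos)
    qed
    also have "\<dots> \<le> (1 + y + y\<^sup>2) * exp (- y)"
      using exp_ge_add_one_self[of "- y"] False assms by (intro mult_left_mono) auto
    finally show ?thesis
      by (simp add: exp_minus field_simps)
  qed
  then show ?thesis
    using exp_ge_add_one_self[of y] using zero_le_power2[of y] by linarith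
qed

text \<open>The first clause of \<open>difference_operator\<close> as a predicate on a single
  function. The class is closed under the operations used below, so integrability becomes a matter
  of applying introduction rules.\<close>

definition bounded_measurable :: "'a measure \<Rightarrow> ('a \<Rightarrow> real) \<Rightarrow> bool" where
  "bounded_measurable M f \<longleftrightarrow> f \<in> borel_measurable M \<and> bounded (f ` space M)"

named_theorems bounded_measurable_intros

lemma bounded_measurableD: "bounded_measurable M f \<Longrightarrow> f \<in> borel_measurable M"
  by (simp add: bounded_measurable_def)

lemma bounded_measurableE:
  assumes "bounded_measurable M f"
  obtains K where "K > 0" "\<And>x. x \<in> space M \<Longrightarrow> \<bar>f x\<bar> \<le> K"
  using assms by (auto simp: bounded_measurable_def bounded_pos)

lemma bounded_measurableI:
  "f \<in> borel_measurable M \<Longrightarrow> (\<And>x. x \<in> space M \<Longrightarrow> \<bar>f x\<bar> \<le> K) \<Longrightarrow> bounded_measurable M f"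
  by (auto simp: bounded_measurable_def bounded_iff intro!: exI[of _ K])

lemma bounded_measurable_const [bounded_measurable_intros]: "bounded_measurable M (\<lambda>x. c)"
  by (rule bounded_measurableI[of _ _ "\<bar>c\<bar>"]) auto

lemma bounded_measurable_add [bounded_measurable_intros]:
  assumes "bounded_measurable M f" "bounded_measurable M g"
  shows "bounded_measurable M (\<lambda>x. f x + g x)"
proof -
  obtain K where K: "\<And>x. x \<in> space M \<Longrightarrow> \<bar>f x\<bar> \<le> K"
    using bounded_measurableE[OF assms(1)] by blast
  obtain L where L: "\<And>x. x \<in> space M \<Longrightarrow> \<bar>g x\<bar> \<le> L"
    using bounded_measurableE[OF assms(2)] by blast
  show ?thesis
    using assms[THEN bounded_measurableD] K L
    by (intro bounded_measurableI[of _ _ "K + L"] borel_measurable_add) force+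
qed

lemma bounded_measurable_mult [bounded_measurable_intros]:
  assumes "bounded_measurable M f" "bounded_measurable M g"
  shows "bounded_measurable M (\<lambda>x. f x * g x)"
proof -
  obtain K where K: "K > 0" "\<And>x. x \<in> space M \<Longrightarrow> \<bar>f x\<bar> \<le> K"
    using bounded_measurableE[OF assms(1)] by blast
  obtain L where L: "\<And>x. x \<in> space M \<Longrightarrow> \<bar>g x\<bar> \<le> L"
    using bounded_measurableE[OF assms(2)] by blast
  show ?thesis
    using assms[THEN bounded_measurableD] K L
    by (intro bounded_measurableI[of _ _ "K * L"] borel_measurable_times)
      (auto simp: abs_mult intro!: mult_mono)
qed

lemma bounded_measurable_diff [bounded_measurable_intros]:
  assumes "bounded_measurable M f" "bounded_measurable M g"
  shows "bounded_measurable M (\<lambda>x. f x - g x)"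
  using bounded_measurable_add[OF assms(1) bounded_measurable_mult[OF bounded_measurable_const[of _ "-1"] assms(2)]]
  by simp

lemma bounded_measurable_power2 [bounded_measurable_intros]:
  assumes "bounded_measurable M f"
  shows "bounded_measurable M (\<lambda>x. (f x)\<^sup>2)"
  unfolding power2_eq_square using assms by (intro bounded_measurable_intros)

lemma bounded_measurable_exp [bounded_measurable_intros]:
  assumes "bounded_measurable M f"
  shows "bounded_measurable M (\<lambda>x. exp (f x))"
proof -
  obtain K where "\<And>x. x \<in> space M \<Longrightarrow> \<bar>f x\<bar> \<le> K"
    using bounded_measurableE[OF assms(1)] by blast
  then show ?thesis
    using assms[THEN bounded_measurableD]
    by (intro bounded_measurableI[of _ _ "exp K"] measurable_compose[OF _ borel_measurable_exp])
      (auto simp: abs_le_iff)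
qed

section \<open>Entropy and exponential moments on a probability space\<close>

context prob_space
begin

lemma bounded_measurable_integrable:
  assumes "bounded_measurable M f"
  shows "integrable M f"
proof -
  obtain K where "\<And>x. x \<in> space M \<Longrightarrow> \<bar>f x\<bar> \<le> K"
    using bounded_measurableE[OF assms(1)] by blast
  then show ?thesis
    using assms[THEN bounded_measurableD] by (intro integrable_const_bound[of _ K] AE_I2) auto
qed

lemma expectation_exp_pos:
  assumes "bounded_measurable M f"
  shows "0 < expectation (\<lambda>x. exp (f x))"
proof -
  obtain K where K: "\<And>x. x \<in> space M \<Longrightarrow> \<bar>f x\<bar> \<le> K"
    using bounded_measurableE[OF assms(1)] by blast
  have "exp (- K) \<le> expectation (\<lambda>x. exp (f x))"
    using K assms
    by (intro integral_ge_const bounded_measurable_integrable bounded_measurable_intros AE_I2)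
      (force simp: abs_le_iff)+
  then show ?thesis
    using exp_gt_zero[of "- K"] by linarith
qed

text \<open>This is the Donsker-Varadhan inequality. It comes from \<open>u + 1 \<le> exp u\<close>
  at \<open>u = (g x - ln W) - (f x - ln Z)\<close>, multiplied by \<open>exp (f x)\<close> and
  integrated; the right-hand side integrates to \<open>Z\<close> and cancels the contribution of the
  summand \<open>1\<close>.\<close>

lemma entropy_duality:
  assumes f: "bounded_measurable M f" and g: "bounded_measurable M g"
  shows "expectation (\<lambda>x. g x * exp (f x))
    \<le> Ent M (\<lambda>x. exp (f x)) + expectation (\<lambda>x. exp (f x)) * ln (expectation (\<lambda>x. exp (g x)))"
proof -
  define Z where "Z = expectation (\<lambda>x. exp (f x))"
  define W where "W = expectation (\<lambda>x. exp (g x))"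
  have Z: "Z > 0" and W: "W > 0"
    using expectation_exp_pos f g by (auto simp: Z_def W_def)
  have pt: "g x * exp (f x) - exp (f x) * f x + (ln Z - ln W + 1) * exp (f x) \<le> Z / W * exp (g x)" for x
  proof -
    have "g x - ln W - f x + ln Z + 1 \<le> exp (g x - ln W - f x + ln Z)"
      using exp_ge_add_one_self[of "g x - ln W - f x + ln Z"] by linarith
    also have "\<dots> = Z / W * exp (g x) / exp (f x)"
      using Z W by (simp add: exp_add exp_diff)
    finally have "(g x - ln W - f x + ln Z + 1) * exp (f x) \<le> Z / W * exp (g x)"
      by (simp only: pos_le_divide_eq[OF exp_gt_zero])
    then show ?thesis
      by (simp add: algebra_simps)
  qed
  have "expectation (\<lambda>x. g x * exp (f x) - exp (f x) * f x + (ln Z - ln W + 1) * exp (f x))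
      \<le> expectation (\<lambda>x. Z / W * exp (g x))"
    using pt f g by (intro integral_mono bounded_measurable_integrable bounded_measurable_intros)
  moreover have "expectation (\<lambda>x. g x * exp (f x) - exp (f x) * f x + (ln Z - ln W + 1) * exp (f x))
     = expectation (\<lambda>x. g x * exp (f x)) - expectation (\<lambda>x. exp (f x) * f x) + (ln Z - ln W + 1) * Z"
  proof -
    have "integrable M (\<lambda>x. exp (f x))" "integrable M (\<lambda>x. g x * exp (f x))"
        "integrable M (\<lambda>x. exp (f x) * f x)"
      using bounded_measurable_integrable[OF bounded_measurable_exp[OF f]]
        bounded_measurable_integrable[OF bounded_measurable_mult[OF g bounded_measurable_exp[OF f]]]
        bounded_measurable_integrable[OF bounded_measurable_mult[OF bounded_measurable_exp[OF f] f]] by auto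
    then show ?thesis
      by (simp add: Z_def)
  qed
  moreover have "expectation (\<lambda>x. Z / W * exp (g x)) = Z"
    using W by (simp add: W_def)
  ultimately show ?thesis
    unfolding Ent_def by (simp add: Z_def[symmetric] W_def[symmetric] algebra_simps)
qed

lemma Ent_exp_nonneg:
  assumes "bounded_measurable M f"
  shows "0 \<le> Ent M (\<lambda>x. exp (f x))"
  using entropy_duality[OF assms bounded_measurable_const[of _ 0]] by (simp add: prob_space)

text \<open>Since \<open>f\<close> is bounded, the second-order remainder of
  \<open>exp (h * f x)\<close> is uniformly of order \<open>h\<^sup>2\<close>, so the expectation of
  the remainder is too and the difference quotient converges.\<close>

lemma DERIV_mgf:
  assumes f: "bounded_measurable M f"
  shows "((\<lambda>l. expectation (\<lambda>x. exp (l * f x))) has_real_derivative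
           expectation (\<lambda>x. f x * exp (l * f x))) (at l)"
proof -
  obtain K where K: "K > 0" "\<And>x. x \<in> space M \<Longrightarrow> \<bar>f x\<bar> \<le> K"
    using bounded_measurableE[OF f] by blast
  define Z where "Z l = expectation (\<lambda>x. exp (l * f x))" for l
  define D where "D = expectation (\<lambda>x. f x * exp (l * f x))"
  define C where "C = K\<^sup>2 * Z l"
  have e: "bounded_measurable M (\<lambda>x. exp (k * f x))" for k
    using f by (intro bounded_measurable_intros)
  note i = bounded_measurable_integrable[OF e] bounded_measurable_integrable[OF bounded_measurable_mult[OF f e]]
  have est: "\<bar>Z (l + h) - Z l - h * D\<bar> \<le> C * h\<^sup>2" if "\<bar>h\<bar> \<le> 1 / K" for h
  proof -
    \<comment> \<open>\<open>R x\<close> is \<open>exp (l * f x)\<close> times the remainder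
      \<open>exp y - 1 - y\<close> at \<open>y = h * f x\<close>; the restriction on
      \<open>h\<close> ensures \<open>\<bar>y\<bar> \<le> 1\<close>.\<close>
    define R where "R x = exp ((l + h) * f x) - exp (l * f x) - h * (f x * exp (l * f x))" for x
    have R: "integrable M R"
      unfolding R_def by (intro Bochner_Integration.integrable_diff integrable_mult_right i)
    have pt: "\<bar>R x\<bar> \<le> K\<^sup>2 * h\<^sup>2 * exp (l * f x)" if x: "x \<in> space M" for x
    proof -
      have le: "\<bar>h * f x\<bar> \<le> \<bar>h\<bar> * K"
        unfolding abs_mult using K(2)[OF x] by (rule mult_left_mono) simp
      also have "\<bar>h\<bar> * K \<le> 1"
        using \<open>\<bar>h\<bar> \<le> 1 / K\<close> K(1) by (simp add: field_simps)
      finally have "\<bar>exp (h * f x) - 1 - h * f x\<bar> \<le> (h * f x)\<^sup>2"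
        by (rule exp_minus_affine_bounds)
      also have "(h * f x)\<^sup>2 = \<bar>h * f x\<bar>\<^sup>2"
        by simp
      also have "\<dots> \<le> (\<bar>h\<bar> * K)\<^sup>2"
        using le by (rule power_mono) simp
      also have "\<dots> = K\<^sup>2 * h\<^sup>2"
        by (simp add: power_mult_distrib)
      finally have "\<bar>exp (h * f x) - 1 - h * f x\<bar> * exp (l * f x) \<le> K\<^sup>2 * h\<^sup>2 * exp (l * f x)"
        by (rule mult_right_mono) simp
      moreover have "R x = (exp (h * f x) - 1 - h * f x) * exp (l * f x)"
        by (simp add: R_def exp_add algebra_simps)
      ultimately show ?thesis
        by (simp add: abs_mult)
    qed
    have "Z (l + h) - Z l - h * D = expectation R"
      unfolding Z_def D_def R_def
      by (subst Bochner_Integration.integral_diff;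
          (intro Bochner_Integration.integrable_diff integrable_mult_right i)?; simp add: i)+
    also have "\<bar>\<dots>\<bar> \<le> expectation (\<lambda>x. \<bar>R x\<bar>)"
      by (rule integral_abs_bound)
    also have "\<dots> \<le> expectation (\<lambda>x. K\<^sup>2 * h\<^sup>2 * exp (l * f x))"
      using pt by (intro integral_mono integrable_abs R integrable_mult_right i)
    also have "\<dots> = C * h\<^sup>2"
      by (simp add: C_def Z_def)
    finally show ?thesis .
  qed
  have "((\<lambda>h. (Z (l + h) - Z l) / h - D) \<longlongrightarrow> 0) (at 0)"
  proof (rule Lim_null_comparison)
    show "((\<lambda>h. C * \<bar>h\<bar>) \<longlongrightarrow> 0) (at 0)"
      by (auto intro!: tendsto_eq_intros)
    have "\<forall>\<^sub>F h in at 0. \<bar>h\<bar> < 1 / K"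
      using K by (intro order_tendstoD(2)[of _ 0]) (auto intro!: tendsto_eq_intros)
    moreover have "\<forall>\<^sub>F h::real in at 0. h \<noteq> 0"
      by (simp add: eventually_at_filter)
    ultimately show "\<forall>\<^sub>F h in at 0. norm ((Z (l + h) - Z l) / h - D) \<le> C * \<bar>h\<bar>"
    proof eventually_elim
      case (elim h)
      have "(Z (l + h) - Z l) / h - D = (Z (l + h) - Z l - h * D) / h"
        using elim by (simp add: field_simps)
      then have "\<bar>(Z (l + h) - Z l) / h - D\<bar> = \<bar>Z (l + h) - Z l - h * D\<bar> / \<bar>h\<bar>"
        by simp
      also have "\<dots> \<le> C * h\<^sup>2 / \<bar>h\<bar>"
        using est[of h] elim by (intro divide_right_mono) auto
      also have "\<dots> = C * \<bar>h\<bar>"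
        using elim by (simp add: power2_eq_square abs_if)
      finally show ?case by simp
    qed
  qed
  then show ?thesis
    unfolding DERIV_def Z_def D_def by (rule LIM_zero_cancel)
qed

text \<open>
  Herbst's argument: \<open>Ent (exp (l f)) / (l\<^sup>2 E exp (l f))\<close> is the derivative of
  \<open>ln (E exp (l f)) / l\<close>, whose limit at \<open>0\<close> is the mean of \<open>f\<close>.
\<close>

lemma Herbst:
  assumes f: "bounded_measurable M f" and s: "0 < s"
    and P: "\<And>l. 0 < l \<Longrightarrow> l < s \<Longrightarrow> (P has_real_derivative P' l) (at l)"
    and cont: "continuous_on {0..s} P"
    and Ent: "\<And>l. 0 < l \<Longrightarrow> l < s \<Longrightarrow>
      Ent M (\<lambda>x. exp (l * f x)) \<le> l\<^sup>2 * expectation (\<lambda>x. exp (l * f x)) * P' l"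
  shows "ln (expectation (\<lambda>x. exp (s * f x))) / s - P s \<le> expectation f - P 0"
proof -
  define Z where "Z l = expectation (\<lambda>x. exp (l * f x))" for l
  define D where "D l = expectation (\<lambda>x. f x * exp (l * f x))" for l
  \<comment> \<open>The quotient would have the default value \<open>0\<close> at
    \<open>l = 0\<close>; the mean of \<open>f\<close>, which is the derivative of
    \<open>ln (Z l)\<close> at \<open>0\<close>, makes \<open>H\<close> continuous there.\<close>
  define H where "H l = (if l = 0 then expectation f else ln (Z l) / l)" for l
  have Zpos: "Z l > 0" for l
    unfolding Z_def using f by (intro expectation_exp_pos bounded_measurable_intros)
  have DZ: "(Z has_real_derivative D l) (at l)" for l
    unfolding Z_def D_def by (rule DERIV_mgf[OF f])
  have DL: "((\<lambda>l. ln (Z l)) has_real_derivative D l / Z l) (at l)" for l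
    using DERIV_chain2[OF DERIV_ln[OF Zpos] DZ] by (simp add: field_simps)
  have Z0: "Z 0 = 1" and D0: "D 0 = expectation f"
    by (simp_all add: Z_def D_def prob_space)
  have DH: "(H has_real_derivative (l * (D l / Z l) - ln (Z l)) / l\<^sup>2) (at l)" if "0 < l" for l
  proof (rule has_field_derivative_transform_within_open[where S = "{0<..}"])
    show "((\<lambda>l. ln (Z l) / l) has_real_derivative (l * (D l / Z l) - ln (Z l)) / l\<^sup>2) (at l)"
      using DERIV_divide[OF DL DERIV_ident, of l] that by (simp add: power2_eq_square mult.commute)
  qed (use that in \<open>auto simp: H_def\<close>)
  have H0: "isCont H 0"
  proof -
    have "((\<lambda>h. ln (Z h) / h) \<longlongrightarrow> expectation f) (at 0)"
      using DL[of 0] by (simp add: DERIV_def Z0 D0)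
    moreover have "((\<lambda>h. ln (Z h) / h) \<longlongrightarrow> expectation f) (at 0)
        \<longleftrightarrow> (H \<longlongrightarrow> expectation f) (at 0)"
      by (intro tendsto_cong) (auto simp: H_def eventually_at_filter)
    ultimately show ?thesis
      by (simp add: isCont_def H_def)
  qed
  have "H s - P s \<le> H 0 - P 0"
  \<comment> \<open>At \<open>0\<close> only continuity of \<open>H\<close> is known, so
    monotonicity is taken from the sign of the derivative in the open interval.\<close>
  proof (rule DERIV_nonpos_imp_decreasing_open[where f = "\<lambda>l. H l - P l"])
    fix l :: real assume l: "0 < l" "l < s"
    define e where "e = (l * (D l / Z l) - ln (Z l)) / l\<^sup>2"
    have "Ent M (\<lambda>x. exp (l * f x)) = l * D l - Z l * ln (Z l)"
      by (simp add: Ent_def Z_def D_def mult_ac flip: integral_mult_right_zero)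
    \<comment> \<open>Here \<open>e\<close> is the derivative of \<open>H\<close> at
      \<open>l\<close>, so the entropy hypothesis says exactly that \<open>H\<close> grows no faster
      than \<open>P\<close>.\<close>
    also have "\<dots> = l\<^sup>2 * Z l * e"
      using Zpos[of l] l by (simp add: e_def diff_divide_distrib right_diff_distrib power2_eq_square)
    finally have "l\<^sup>2 * Z l * e \<le> l\<^sup>2 * Z l * P' l"
      using Ent[OF l] by (simp add: Z_def)
    then have "e \<le> P' l"
      using Zpos[of l] l by simp
    moreover have "((\<lambda>l. H l - P l) has_real_derivative e - P' l) (at l)"
      unfolding e_def using l by (intro DERIV_diff DH P)
    ultimately show "\<exists>y. ((\<lambda>l. H l - P l) has_real_derivative y) (at l) \<and> y \<le> 0"
      by force
  next
    have "isCont H l" if "0 \<le> l" for l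
      using H0 DERIV_isCont[OF DH] that by (cases "l = 0") auto
    then show "continuous_on {0..s} (\<lambda>l. H l - P l)"
      by (intro continuous_on_diff cont continuous_at_imp_continuous_on) auto
  qed (use s in auto)
  then show ?thesis
    using s by (simp add: H_def Z_def)
qed

end

section \<open>From exponential moments to the two-level tail\<close>

text \<open>For \<open>v = 0\<close> the extended quotient is infinite when \<open>0 < t\<close>,
  leaving \<open>t / b\<close>; when \<open>t = 0\<close> both arguments vanish. Afterwards only
  real arithmetic is needed.\<close>

lemma ereal_min_two_level:
  assumes "0 \<le> v" "0 < b" "0 \<le> t"
  shows "real_of_ereal (min (ereal (t\<^sup>2) / ereal (2 * v)) (ereal (t / b)))
    = (if v = 0 then t / b else min (t\<^sup>2 / (2 * v)) (t / b))"
proof (cases "v = 0")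
  case True
  then show ?thesis
    using assms by (cases "t = 0") (auto simp: ereal_division_convention min_def divide_ereal_def)
next
  case False
  then show ?thesis
    by (simp add: min_def)
qed

text \<open>Chernoff's bound has exponent \<open>2 * \<rho> * l\<^sup>2 * v - l * t\<close>.
  Optimising this quadratic over \<open>0 \<le> l \<le> 1 / (2 * \<rho> * b)\<close> produces the
  two regimes of the minimum.\<close>

lemma (in prob_space) two_level_tail:
  assumes f: "bounded_measurable M f" and v: "0 \<le> v" and b: "0 < b" and \<rho>: "0 < \<rho>" and t: "0 \<le> t"
    and mgf: "\<And>l. 0 < l \<Longrightarrow> 2 * \<rho> * b * l \<le> 1 \<Longrightarrow>
      expectation (\<lambda>x. exp (l * f x)) \<le> exp (2 * \<rho> * l\<^sup>2 * v)"
  shows "prob {x \<in> space M. t \<le> f x} \<le> two_level_bound \<rho> v b t"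
proof -
  have chernoff: "prob {x \<in> space M. t \<le> f x} \<le> exp (2 * \<rho> * l\<^sup>2 * v - l * t)"
    if l: "0 \<le> l" "2 * \<rho> * b * l \<le> 1" for l
  \<comment> \<open>The moment hypothesis covers only \<open>0 < l\<close>. At \<open>l = 0\<close>,
    which is the choice made below when \<open>t = 0\<close> and \<open>v \<noteq> 0\<close>, the
    bound is \<open>1\<close>.\<close>
  proof (cases "l = 0")
    case False
    have int: "integrable M (\<lambda>x. exp (l * f x))"
      using f by (intro bounded_measurable_integrable bounded_measurable_intros)
    have "prob {x \<in> space M. t \<le> f x}
        \<le> exp (- l * t) * set_lebesgue_integral M (space M) (\<lambda>x. exp (l * f x))"
      using l False int
      by (intro Chernoff_ineq_ge) (auto simp: set_integrable_def cong: Bochner_Integration.integrable_cong)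
    also have "set_lebesgue_integral M (space M) (\<lambda>x. exp (l * f x)) = expectation (\<lambda>x. exp (l * f x))"
      using int by (rule set_integral_space)
    also have "exp (- l * t) * \<dots> \<le> exp (- l * t) * exp (2 * \<rho> * l\<^sup>2 * v)"
      using mgf l False by (intro mult_left_mono) auto
    finally show ?thesis
      by (simp add: exp_add[symmetric] algebra_simps)
  qed simp
  define m where "m = (if v = 0 then t / b else min (t\<^sup>2 / (2 * v)) (t / b))"
  have "\<exists>l\<ge>0. 2 * \<rho> * b * l \<le> 1 \<and> 2 * \<rho> * l\<^sup>2 * v - l * t \<le> - (1 / (4 * \<rho>)) * m"
  \<comment> \<open>The unconstrained minimiser \<open>t / (4 * \<rho> * v)\<close> is admissible
    exactly when \<open>b * t \<le> 2 * v\<close>. Otherwise, and for \<open>v = 0\<close>, the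
    endpoint \<open>1 / (2 * \<rho> * b)\<close> is used.\<close>
  proof (cases "b * t \<le> 2 * v \<and> v \<noteq> 0")
    case True
    have "2 * \<rho> * (t / (4 * \<rho> * v))\<^sup>2 * v - t / (4 * \<rho> * v) * t = - (1 / (4 * \<rho>)) * (t\<^sup>2 / (2 * v))"
      using True \<rho> by (simp add: field_simps power2_eq_square)
    also have "\<dots> \<le> - (1 / (4 * \<rho>)) * m"
      using True \<rho> by (intro mult_left_mono_neg) (auto simp: m_def)
    finally show ?thesis
      using True \<rho> v t by (intro exI[of _ "t / (4 * \<rho> * v)"]) (auto simp: field_simps)
  next
    case False
    then have "2 * v \<le> b * t"
      using b t by auto
    have "2 * \<rho> * (1 / (2 * \<rho> * b))\<^sup>2 * v = 2 * v / (4 * \<rho> * b\<^sup>2)"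
      using \<rho> b by (simp add: field_simps power2_eq_square)
    also have "\<dots> \<le> b * t / (4 * \<rho> * b\<^sup>2)"
      using \<open>2 * v \<le> b * t\<close> \<rho> by (intro divide_right_mono) auto
    also have "\<dots> = t / (4 * \<rho> * b)"
      using b by (simp add: power2_eq_square)
    finally have "2 * \<rho> * (1 / (2 * \<rho> * b))\<^sup>2 * v - 1 / (2 * \<rho> * b) * t \<le> t / (4 * \<rho> * b) - 1 / (2 * \<rho> * b) * t"
      by simp
    also have "\<dots> = - (1 / (4 * \<rho>)) * (t / b)"
      using b \<rho> by (simp add: field_simps)
    also have "\<dots> \<le> - (1 / (4 * \<rho>)) * m"
      using \<rho> by (intro mult_left_mono_neg) (auto simp: m_def)
    finally show ?thesis
      using \<rho> b by (intro exI[of _ "1 / (2 * \<rho> * b)"]) auto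
  qed
  then obtain l where l: "0 \<le> l" "2 * \<rho> * b * l \<le> 1"
      "2 * \<rho> * l\<^sup>2 * v - l * t \<le> - (1 / (4 * \<rho>)) * m" by blast
  have "two_level_bound \<rho> v b t = exp (- (1 / (4 * \<rho>)) * m)"
    unfolding two_level_bound_def ereal_min_two_level[OF v b t] m_def ..
  then show ?thesis
    using chernoff[OF l(1,2)] l(3) by (simp add: order_trans)
qed

section \<open>Exponential moments under the modified logarithmic Sobolev inequality\<close>

text \<open>The hypothesis on squares stays outside the locale because the two tails use different
  versions of it.\<close>

locale mLSI_space = prob_space M for M :: "'a measure" +
  fixes \<A> :: "('a \<Rightarrow> real) set" and \<Gamma> :: "('a \<Rightarrow> real) \<Rightarrow> 'a \<Rightarrow> real" and \<rho> :: real
  assumes difference_operator: "difference_operator M \<A> \<Gamma>" and mLSI: "mLSI M \<A> \<Gamma> \<rho>"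
begin

lemma rho_pos: "0 < \<rho>"
  using mLSI by (simp add: mLSI_def)

lemma bounded_measurable_mem: "f \<in> \<A> \<Longrightarrow> bounded_measurable M f"
  using difference_operator by (auto simp: difference_operator_def bounded_measurable_def)

lemma Gamma_nonneg: "f \<in> \<A> \<Longrightarrow> x \<in> space M \<Longrightarrow> 0 \<le> \<Gamma> f x"
  using difference_operator by (auto simp: difference_operator_def)

lemma affine_mem: "f \<in> \<A> \<Longrightarrow> 0 \<le> a \<Longrightarrow> (\<lambda>x. a * f x + c) \<in> \<A>"
  using difference_operator by (auto simp: difference_operator_def)

lemma Gamma_affine: "f \<in> \<A> \<Longrightarrow> 0 \<le> a \<Longrightarrow> x \<in> space M \<Longrightarrow> \<Gamma> (\<lambda>x. a * f x + c) x = a * \<Gamma> f x"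
  using difference_operator by (auto simp: difference_operator_def)

text \<open>Homogeneity of \<open>\<Gamma>\<close> turns the Sobolev inequality for
  \<open>l * f\<close> into a factor \<open>l\<^sup>2\<close>. The bounded majorant \<open>h\<close>
  makes the nonnegative integral finite, so that the estimate becomes one between real
  expectations.\<close>

lemma Ent_le:
  assumes f: "f \<in> \<A>" and h: "bounded_measurable M h" and l: "0 \<le> l"
    and le: "\<And>x. x \<in> space M \<Longrightarrow> (\<Gamma> f x)\<^sup>2 \<le> h x"
  shows "Ent M (\<lambda>x. exp (l * f x)) \<le> \<rho> / 2 * l\<^sup>2 * expectation (\<lambda>x. h x * exp (l * f x))"
proof -
  \<comment> \<open>The summand \<open>0\<close> gives the literal shape \<open>a * f x + b\<close>
    required by \<open>affine_mem\<close> and \<open>Gamma_affine\<close>.\<close>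
  define F where "F = (\<lambda>x. l * f x + 0)"
  have F: "F \<in> \<A>"
    unfolding F_def using f l by (rule affine_mem)
  have h0: "0 \<le> h x" if "x \<in> space M" for x
    using le[OF that] zero_le_power2[of "\<Gamma> f x"] by linarith
  have bm: "bounded_measurable M (\<lambda>x. l\<^sup>2 * (h x * exp (l * f x)))"
    using bounded_measurable_mem[OF f] h by (intro bounded_measurable_intros)
  have "ennreal (Ent M (\<lambda>x. exp (F x))) \<le> ennreal (\<rho> / 2) * (\<integral>\<^sup>+x. ennreal ((\<Gamma> F x)\<^sup>2 * exp (F x)) \<partial>M)"
    using mLSI F by (auto simp: mLSI_def)
  also have "\<dots> \<le> ennreal (\<rho> / 2) * (\<integral>\<^sup>+x. ennreal (l\<^sup>2 * (h x * exp (l * f x))) \<partial>M)"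
  proof (intro mult_left_mono nn_integral_mono ennreal_leI)
    fix x assume x: "x \<in> space M"
    have "(\<Gamma> F x)\<^sup>2 * exp (F x) = l\<^sup>2 * ((\<Gamma> f x)\<^sup>2 * exp (l * f x))"
      unfolding F_def Gamma_affine[OF f l x] by (simp add: power_mult_distrib)
    also have "\<dots> \<le> l\<^sup>2 * (h x * exp (l * f x))"
      using le[OF x] by (intro mult_left_mono mult_right_mono) auto
    finally show "(\<Gamma> F x)\<^sup>2 * exp (F x) \<le> l\<^sup>2 * (h x * exp (l * f x))" .
  qed simp
  also have "(\<integral>\<^sup>+x. ennreal (l\<^sup>2 * (h x * exp (l * f x))) \<partial>M)
      = ennreal (expectation (\<lambda>x. l\<^sup>2 * (h x * exp (l * f x))))"
    using bm h0 by (intro nn_integral_eq_integral bounded_measurable_integrable AE_I2) auto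
  also have "ennreal (\<rho> / 2) * \<dots> = ennreal (\<rho> / 2 * expectation (\<lambda>x. l\<^sup>2 * (h x * exp (l * f x))))"
    using rho_pos by (intro ennreal_mult'[symmetric]) auto
  finally have "Ent M (\<lambda>x. exp (F x)) \<le> \<rho> / 2 * expectation (\<lambda>x. l\<^sup>2 * (h x * exp (l * f x)))"
    using rho_pos h0 by (subst (asm) ennreal_le_iff) (auto intro!: mult_nonneg_nonneg integral_nonneg_AE)
  then show ?thesis
    by (simp add: F_def)
qed

text \<open>From \<open>\<Gamma> (h\<^sup>2) \<le> 2 h b\<close> the entropy of
  \<open>exp (l h\<^sup>2)\<close> is at most \<open>\<kappa> l\<^sup>2\<close> times the derivative
  of its own moment generating function \<open>Z\<close>. Hence \<open>P = \<kappa> ln Z\<close> is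
  a valid comparison function in Herbst's argument.\<close>

lemma mgf_square_pos:
  assumes h: "h \<in> \<A>" and pos: "\<And>x. x \<in> space M \<Longrightarrow> 0 < h x"
    and sq: "(\<lambda>x. (h x)\<^sup>2) \<in> \<A>" "\<And>x. x \<in> space M \<Longrightarrow> \<Gamma> (\<lambda>x. (h x)\<^sup>2) x \<le> 2 * h x * \<Gamma> h x"
    and b: "0 < b" "\<And>x. x \<in> space M \<Longrightarrow> \<Gamma> h x \<le> b"
  shows "ln (expectation (\<lambda>x. exp (1 / (4 * \<rho> * b\<^sup>2) * (h x)\<^sup>2)))
    \<le> expectation (\<lambda>x. (h x)\<^sup>2) / (2 * \<rho> * b\<^sup>2)"
proof -
  define \<phi> where "\<phi> = (\<lambda>x. (h x)\<^sup>2)"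
  have \<phi>: "bounded_measurable M \<phi>"
    using bounded_measurable_mem[OF sq(1)] by (simp add: \<phi>_def)
  define Z where "Z l = expectation (\<lambda>x. exp (l * \<phi> x))" for l
  define D where "D l = expectation (\<lambda>x. \<phi> x * exp (l * \<phi> x))" for l
  define \<kappa> where "\<kappa> = 2 * \<rho> * b\<^sup>2"
  have \<kappa>: "\<kappa> > 0"
    using rho_pos b by (simp add: \<kappa>_def)
  have Zpos: "Z l > 0" for l
    unfolding Z_def using \<phi> by (intro expectation_exp_pos bounded_measurable_intros)
  have DP: "((\<lambda>l. \<kappa> * ln (Z l)) has_real_derivative \<kappa> * (D l / Z l)) (at l)" for l
    using DERIV_cmult[OF DERIV_chain2[OF DERIV_ln[OF Zpos] DERIV_mgf[OF \<phi>, folded Z_def D_def]], of \<kappa>]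
    by (simp add: field_simps)
  \<comment> \<open>At the endpoint \<open>1 / (2 * \<kappa>)\<close> the first term is
    \<open>2 * \<kappa> * ln Z\<close> and the subtracted one \<open>\<kappa> * ln Z\<close>, so a
    positive multiple of \<open>ln Z\<close> remains.\<close>
  have "ln (expectation (\<lambda>x. exp (1 / (2 * \<kappa>) * \<phi> x))) / (1 / (2 * \<kappa>)) - \<kappa> * ln (Z (1 / (2 * \<kappa>)))
      \<le> expectation \<phi> - \<kappa> * ln (Z 0)"
  proof (rule Herbst[OF \<phi> _ DP])
    show "continuous_on {0..1 / (2 * \<kappa>)} (\<lambda>l. \<kappa> * ln (Z l))"
      using DERIV_isCont[OF DP] by (intro continuous_at_imp_continuous_on) auto
    fix l :: real assume l: "0 < l"
    have "Ent M (\<lambda>x. exp (l * \<phi> x)) \<le> \<rho> / 2 * l\<^sup>2 * expectation (\<lambda>x. 4 * b\<^sup>2 * \<phi> x * exp (l * \<phi> x))"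
    proof (rule Ent_le)
      fix x assume x: "x \<in> space M"
      have "\<Gamma> \<phi> x \<le> 2 * h x * \<Gamma> h x"
        using sq(2)[OF x] by (simp add: \<phi>_def)
      also have "\<dots> \<le> 2 * h x * b"
        using b(2)[OF x] pos[OF x] by (intro mult_left_mono) auto
      finally have "(\<Gamma> \<phi> x)\<^sup>2 \<le> (2 * h x * b)\<^sup>2"
        using Gamma_nonneg[OF sq(1) x] by (intro power_mono) (auto simp: \<phi>_def)
      then show "(\<Gamma> \<phi> x)\<^sup>2 \<le> 4 * b\<^sup>2 * \<phi> x"
        by (simp add: \<phi>_def power_mult_distrib mult_ac)
    next
      show "bounded_measurable M (\<lambda>x. 4 * b\<^sup>2 * \<phi> x)"
        using \<phi> by (intro bounded_measurable_intros)
    qed (use sq l in \<open>auto simp: \<phi>_def\<close>)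
    also have "\<dots> = l\<^sup>2 * Z l * (\<kappa> * (D l / Z l))"
      using Zpos[of l] by (simp add: \<kappa>_def D_def mult.assoc)
    finally show "Ent M (\<lambda>x. exp (l * \<phi> x)) \<le> l\<^sup>2 * expectation (\<lambda>x. exp (l * \<phi> x)) * (\<kappa> * (D l / Z l))"
      by (simp add: Z_def)
  qed (use \<kappa> in auto)
  moreover have "Z 0 = 1"
    by (simp add: Z_def prob_space)
  ultimately have "\<kappa> * ln (Z (1 / (2 * \<kappa>))) \<le> expectation \<phi>"
    by (simp add: Z_def)
  then have "ln (Z (1 / (2 * \<kappa>))) \<le> expectation \<phi> / \<kappa>"
    using \<kappa> by (simp add: field_simps)
  moreover have "1 / (4 * \<rho> * b\<^sup>2) = 1 / (2 * \<kappa>)"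
    by (simp add: \<kappa>_def)
  ultimately show ?thesis
    by (simp only: \<kappa>_def \<phi>_def Z_def)
qed

text \<open>The hypothesis on squares concerns positive functions, whereas \<open>g\<close> may
  vanish. Adding a constant \<open>e > 0\<close> leaves \<open>\<Gamma> g\<close> unchanged and
  changes the second moment by an amount that tends to \<open>0\<close> with
  \<open>e\<close>.\<close>

lemma mgf_square:
  assumes sq: "\<And>h. h \<in> \<A> \<Longrightarrow> (\<And>x. x \<in> space M \<Longrightarrow> 0 < h x) \<Longrightarrow>
      (\<lambda>x. (h x)\<^sup>2) \<in> \<A> \<and> (\<forall>x\<in>space M. \<Gamma> (\<lambda>x. (h x)\<^sup>2) x \<le> 2 * h x * \<Gamma> h x)"
    and g: "g \<in> \<A>" and nonneg: "\<And>x. x \<in> space M \<Longrightarrow> 0 \<le> g x"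
    and b: "0 < b" "\<And>x. x \<in> space M \<Longrightarrow> \<Gamma> g x \<le> b"
  shows "ln (expectation (\<lambda>x. exp (1 / (4 * \<rho> * b\<^sup>2) * (g x)\<^sup>2)))
    \<le> expectation (\<lambda>x. (g x)\<^sup>2) / (2 * \<rho> * b\<^sup>2)"
proof -
  define s where "s = 1 / (4 * \<rho> * b\<^sup>2)"
  have s: "s \<ge> 0"
    using rho_pos by (simp add: s_def)
  have bg: "bounded_measurable M g"
    using g by (rule bounded_measurable_mem)
  have "ln (expectation (\<lambda>x. exp (s * (g x)\<^sup>2)))
      \<le> (expectation (\<lambda>x. (g x)\<^sup>2) + 2 * e * expectation g + e\<^sup>2) / (2 * \<rho> * b\<^sup>2)"
    if e: "e > 0" for e
  proof -
    define h where "h = (\<lambda>x. 1 * g x + e)"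
    have h: "h \<in> \<A>"
      unfolding h_def using g by (intro affine_mem) auto
    have pos: "0 < h x" if "x \<in> space M" for x
      using nonneg[OF that] e by (simp add: h_def)
    have "expectation (\<lambda>x. exp (s * (g x)\<^sup>2)) \<le> expectation (\<lambda>x. exp (s * (h x)\<^sup>2))"
      using nonneg e s bg bounded_measurable_mem[OF h]
      by (intro integral_mono bounded_measurable_integrable bounded_measurable_intros)
        (auto simp: h_def intro!: mult_left_mono power_mono)
    then have "ln (expectation (\<lambda>x. exp (s * (g x)\<^sup>2))) \<le> ln (expectation (\<lambda>x. exp (s * (h x)\<^sup>2)))"
      using bg bounded_measurable_mem[OF h]
      by (subst ln_le_cancel_iff) (auto intro!: expectation_exp_pos bounded_measurable_intros)
    also have "\<dots> \<le> expectation (\<lambda>x. (h x)\<^sup>2) / (2 * \<rho> * b\<^sup>2)"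
      unfolding s_def
    proof (rule mgf_square_pos[OF h pos _ _ b(1)])
      show "\<Gamma> h x \<le> b" if "x \<in> space M" for x
        using Gamma_affine[OF g _ that, of 1 e] b(2)[OF that] by (simp add: h_def)
    qed (use sq[OF h pos] in auto)
    also have "expectation (\<lambda>x. (h x)\<^sup>2) = expectation (\<lambda>x. (g x)\<^sup>2 + 2 * e * g x + e\<^sup>2)"
      by (simp add: h_def power2_eq_square algebra_simps)
    also have "\<dots> = expectation (\<lambda>x. (g x)\<^sup>2) + 2 * e * expectation g + e\<^sup>2"
      using bounded_measurable_integrable[OF bg]
        bounded_measurable_integrable[OF bounded_measurable_power2[OF bg]] by (simp add: prob_space)
    finally show ?thesis .
  qed
  moreover have "((\<lambda>e. (expectation (\<lambda>x. (g x)\<^sup>2) + 2 * e * expectation g + e\<^sup>2) / (2 * \<rho> * b\<^sup>2))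
      \<longlongrightarrow> (expectation (\<lambda>x. (g x)\<^sup>2) + 2 * 0 * expectation g + 0\<^sup>2) / (2 * \<rho> * b\<^sup>2)) (at_right 0)"
    using rho_pos b by (intro tendsto_intros) auto
  ultimately have "ln (expectation (\<lambda>x. exp (s * (g x)\<^sup>2)))
      \<le> (expectation (\<lambda>x. (g x)\<^sup>2) + 2 * 0 * expectation g + 0\<^sup>2) / (2 * \<rho> * b\<^sup>2)"
    by (intro tendsto_lowerbound[rotated 1]) (auto simp: eventually_at_filter)
  then show ?thesis
    by (simp add: s_def)
qed

text \<open>The entropy of \<open>exp (m f)\<close> is bounded by a weighted mean of
  \<open>g\<^sup>2\<close>, and duality bounds that mean by the entropy again. The restriction on
  \<open>l\<close> keeps the coefficient of the returning entropy at most
  \<open>1 / 2\<close>.\<close>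

lemma mgf_bound:
  assumes sq: "\<And>h. h \<in> \<A> \<Longrightarrow> (\<And>x. x \<in> space M \<Longrightarrow> 0 < h x) \<Longrightarrow>
      (\<lambda>x. (h x)\<^sup>2) \<in> \<A> \<and> (\<forall>x\<in>space M. \<Gamma> (\<lambda>x. (h x)\<^sup>2) x \<le> 2 * h x * \<Gamma> h x)"
    and f: "f \<in> \<A>" and g: "g \<in> \<A>" and fg: "\<And>x. x \<in> space M \<Longrightarrow> \<Gamma> f x \<le> g x"
    and b: "0 < b" "\<And>x. x \<in> space M \<Longrightarrow> \<Gamma> g x \<le> b"
    and l: "0 < l" "2 * \<rho> * b * l \<le> 1"
  shows "expectation (\<lambda>x. exp (l * (f x - expectation f)))
    \<le> exp (2 * \<rho> * l\<^sup>2 * expectation (\<lambda>x. (g x)\<^sup>2))"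
proof -
  define v where "v = expectation (\<lambda>x. (g x)\<^sup>2)"
  define s where "s = 1 / (4 * \<rho> * b\<^sup>2)"
  have s: "s > 0"
    using rho_pos b by (simp add: s_def)
  have bf: "bounded_measurable M f" and bg: "bounded_measurable M g"
    using f g by (auto intro: bounded_measurable_mem)
  have g0: "0 \<le> g x" if "x \<in> space M" for x
    using Gamma_nonneg[OF f that] fg[OF that] by linarith
  have W: "ln (expectation (\<lambda>x. exp (s * (g x)\<^sup>2))) \<le> 2 * s * v"
    using mgf_square[OF sq g g0 b] by (simp add: s_def v_def)
  have Ent: "Ent M (\<lambda>x. exp (m * f x)) \<le> m\<^sup>2 * expectation (\<lambda>x. exp (m * f x)) * (2 * \<rho> * v)"
    if m: "0 < m" "m < l" for m
  proof -
    define E where "E = Ent M (\<lambda>x. exp (m * f x))"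
    define Z where "Z = expectation (\<lambda>x. exp (m * f x))"
    define G where "G = expectation (\<lambda>x. (g x)\<^sup>2 * exp (m * f x))"
    have bmf: "bounded_measurable M (\<lambda>x. m * f x)"
      using bf by (intro bounded_measurable_intros)
    have E0: "0 \<le> E"
      unfolding E_def using bmf by (rule Ent_exp_nonneg)
    have Z0: "0 < Z"
      unfolding Z_def using bmf by (rule expectation_exp_pos)
    \<comment> \<open>Duality is applied to \<open>s * (g x)\<^sup>2\<close>, with \<open>s\<close>
      exactly the exponent for which \<open>mgf_square\<close> supplies the bound
      \<open>W\<close>.\<close>
    have "s * G = expectation (\<lambda>x. s * (g x)\<^sup>2 * exp (m * f x))"
      by (simp add: G_def mult.assoc)
    also have "\<dots> \<le> E + Z * ln (expectation (\<lambda>x. exp (s * (g x)\<^sup>2)))"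
      unfolding E_def Z_def using bg by (intro entropy_duality bmf bounded_measurable_intros)
    also have "\<dots> \<le> E + Z * (2 * s * v)"
      using W Z0 by (intro add_left_mono mult_left_mono) auto
    finally have "G \<le> (E + Z * (2 * s * v)) / s"
      using s by (simp add: pos_le_divide_eq mult.commute)
    also have "\<dots> = 4 * \<rho> * b\<^sup>2 * E + 2 * v * Z"
      using s by (simp add: add_divide_distrib) (simp add: s_def)
    finally have G: "G \<le> 4 * \<rho> * b\<^sup>2 * E + 2 * v * Z" .
    have "E \<le> \<rho> / 2 * m\<^sup>2 * G"
      unfolding E_def G_def
    proof (rule Ent_le)
      show "(\<Gamma> f x)\<^sup>2 \<le> (g x)\<^sup>2" if "x \<in> space M" for x
        using fg Gamma_nonneg[OF f] that by (intro power_mono) auto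
    qed (use f bg m in \<open>auto intro: bounded_measurable_intros\<close>)
    also have "\<dots> \<le> \<rho> / 2 * m\<^sup>2 * (4 * \<rho> * b\<^sup>2 * E + 2 * v * Z)"
      using rho_pos G by (intro mult_left_mono) auto
    also have "\<dots> = (2 * \<rho> * b * m)\<^sup>2 / 2 * E + \<rho> * m\<^sup>2 * v * Z"
      by (simp add: power2_eq_square algebra_simps)
    also have "\<dots> \<le> 1 / 2 * E + \<rho> * m\<^sup>2 * v * Z"
    proof -
      have "2 * \<rho> * b * m \<le> 2 * \<rho> * b * l"
        using m rho_pos b by (intro mult_left_mono) auto
      then have "2 * \<rho> * b * m \<le> 1"
        using l by linarith
      then have "(2 * \<rho> * b * m)\<^sup>2 \<le> 1"
        using m rho_pos b by (intro power_le_one) auto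
      then show ?thesis
        using E0 by (intro add_right_mono mult_right_mono) auto
    qed
    \<comment> \<open>Half of \<open>E\<close> is moved to the left-hand side; this doubles the
      constant \<open>\<rho> * v\<close>.\<close>
    finally have "E \<le> m\<^sup>2 * Z * (2 * \<rho> * v)"
      by (simp add: algebra_simps)
    then show ?thesis
      by (simp add: E_def Z_def)
  qed
  \<comment> \<open>The entropy bound has the constant \<open>2 * \<rho> * v\<close> as
    \<open>P'\<close>, so the comparison function is linear.\<close>
  have "ln (expectation (\<lambda>x. exp (l * f x))) / l - 2 * \<rho> * v * l \<le> expectation f - 2 * \<rho> * v * 0"
  proof (rule Herbst[OF bf l(1) _ _ Ent])
    show "((\<lambda>l. 2 * \<rho> * v * l) has_real_derivative 2 * \<rho> * v) (at m)" for m
      using DERIV_cmult[OF DERIV_ident, of "2 * \<rho> * v"] by simp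
    show "continuous_on {0..l} (\<lambda>l. 2 * \<rho> * v * l)"
      by (intro continuous_intros)
  qed
  then have "ln (expectation (\<lambda>x. exp (l * f x))) \<le> (expectation f + 2 * \<rho> * v * l) * l"
    using l(1) by (simp flip: pos_divide_le_eq)
  also have "\<dots> = l * expectation f + 2 * \<rho> * l\<^sup>2 * v"
    by (simp add: power2_eq_square algebra_simps)
  finally have "exp (ln (expectation (\<lambda>x. exp (l * f x)))) \<le> exp (l * expectation f + 2 * \<rho> * l\<^sup>2 * v)"
    by (subst exp_le_cancel_iff)
  also have "exp (ln (expectation (\<lambda>x. exp (l * f x)))) = expectation (\<lambda>x. exp (l * f x))"
    using bf by (intro exp_ln expectation_exp_pos bounded_measurable_intros)
  finally have "expectation (\<lambda>x. exp (l * f x)) / exp (l * expectation f) \<le> exp (2 * \<rho> * l\<^sup>2 * v)"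
    by (simp add: exp_add pos_divide_le_eq mult.commute)
  moreover have "expectation (\<lambda>x. exp (l * (f x - expectation f)))
      = expectation (\<lambda>x. exp (l * f x)) / exp (l * expectation f)"
    by (simp add: exp_diff right_diff_distrib)
  ultimately show ?thesis
    by (simp add: v_def)
qed

section \<open>The lower tail through an approximate negation\<close>

text \<open>
  \<open>\<A>\<close> need not contain \<open>- f\<close>. For large \<open>c\<close>, the function
  \<open>((f - c)\<^sup>2 - c\<^sup>2) / (2 (c + K))\<close> is uniformly close to \<open>- f\<close>, and the hypothesis on squares
  bounds its \<open>\<Gamma>\<close> by \<open>\<Gamma> f\<close> as soon as \<open>\<bar>f\<bar> \<le> K\<close>.
\<close>

lemma approx_minus:
  assumes sq: "\<And>h. h \<in> \<A> \<Longrightarrow> (\<lambda>x. (h x)\<^sup>2) \<in> \<A> \<and>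
      (\<forall>x\<in>space M. \<Gamma> (\<lambda>x. (h x)\<^sup>2) x \<le> 2 * \<bar>h x\<bar> * \<Gamma> h x)"
    and f: "f \<in> \<A>" and d: "0 < d"
  obtains F where "F \<in> \<A>" "\<And>x. x \<in> space M \<Longrightarrow> \<Gamma> F x \<le> \<Gamma> f x"
    "\<And>x. x \<in> space M \<Longrightarrow> \<bar>F x + f x\<bar> \<le> d"
proof -
  obtain K where K: "K > 0" "\<And>x. x \<in> space M \<Longrightarrow> \<bar>f x\<bar> \<le> K"
    using bounded_measurableE[OF bounded_measurable_mem[OF f]] by blast
  \<comment> \<open>The error turns out to be at most \<open>3 * K\<^sup>2 / (2 * (c + K))\<close>;
    this \<open>c\<close> gives \<open>2 * c * d = 4 * K\<^sup>2\<close>, which suffices.\<close>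
  define c where "c = 2 * K\<^sup>2 / d"
  \<comment> \<open>On the space \<open>\<bar>f x - c\<bar> \<le> c + K\<close>, so this scaling
    makes the factor in front of \<open>\<Gamma> f\<close> at most \<open>1\<close>.\<close>
  define a where "a = 1 / (2 * (c + K))"
  define h where "h = (\<lambda>x. 1 * f x + (- c))"
  define F where "F = (\<lambda>x. a * (h x)\<^sup>2 + (- (a * c\<^sup>2)))"
  have c: "c > 0" and a: "a \<ge> 0"
    using K d by (auto simp: c_def a_def)
  have h: "h \<in> \<A>"
    unfolding h_def using f by (intro affine_mem) auto
  show ?thesis
  proof
    show "F \<in> \<A>"
      unfolding F_def using sq[OF h] a by (intro affine_mem) auto
    fix x assume x: "x \<in> space M"
    have "\<Gamma> F x = a * \<Gamma> (\<lambda>x. (h x)\<^sup>2) x"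
      unfolding F_def using sq[OF h] a x by (intro Gamma_affine) auto
    also have "\<dots> \<le> a * (2 * \<bar>h x\<bar> * \<Gamma> h x)"
      using sq[OF h] a x by (intro mult_left_mono) auto
    also have "\<dots> \<le> a * (2 * (c + K) * \<Gamma> h x)"
      using K(2)[OF x] c a Gamma_nonneg[OF h x]
      by (intro mult_left_mono mult_right_mono) (auto simp: h_def)
    also have "\<dots> = \<Gamma> f x"
      using c K Gamma_affine[OF f _ x, of 1 "- c"] by (simp add: a_def h_def)
    finally show "\<Gamma> F x \<le> \<Gamma> f x" .
    have "a * (2 * (c + K)) = 1"
      using c K by (simp add: a_def)
    \<comment> \<open>Writing \<open>f x\<close> as \<open>a * (2 * (c + K)) * f x\<close> cancels
      the large linear term \<open>- 2 * a * c * f x\<close> of \<open>F\<close>.\<close>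
    then have "F x + f x = a * ((f x)\<^sup>2 - 2 * c * f x) + a * (2 * (c + K)) * f x"
      by (simp only:) (simp add: F_def h_def power2_eq_square algebra_simps)
    also have "\<dots> = a * (2 * K * f x + (f x)\<^sup>2)"
      by (simp add: algebra_simps)
    finally have "F x + f x = (2 * K * f x + (f x)\<^sup>2) / (2 * (c + K))"
      by (simp add: a_def)
    moreover have "\<bar>2 * K * f x + (f x)\<^sup>2\<bar> \<le> 2 * K * K + K * K"
    proof (rule order_trans[OF abs_triangle_ineq add_mono])
      show "\<bar>2 * K * f x\<bar> \<le> 2 * K * K"
        using K(1) K(2)[OF x] by (simp add: abs_mult)
      show "\<bar>(f x)\<^sup>2\<bar> \<le> K * K"
        using power_mono[OF K(2)[OF x], of 2] by (simp add: power2_eq_square)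
    qed
    ultimately have "\<bar>F x + f x\<bar> \<le> (2 * K * K + K * K) / (2 * (c + K))"
      using c K by (simp add: divide_right_mono)
    also have "\<dots> \<le> d"
    proof -
      have "c * d = 2 * K\<^sup>2"
        using d by (simp add: c_def)
      moreover have "0 \<le> K * d"
        using K d by simp
      moreover have "d * (2 * (c + K)) = 2 * (c * d) + 2 * (K * d)"
        by (simp add: algebra_simps)
      ultimately have "2 * K * K + K * K \<le> d * (2 * (c + K))"
        using zero_le_power2[of K] by (simp add: power2_eq_square)
      then show ?thesis
        using c K by (simp add: pos_divide_le_eq)
    qed
    finally show "\<bar>F x + f x\<bar> \<le> d" .
  qed
qed

text \<open>The upper-tail estimate applies to a function \<open>F\<close> in \<open>\<A>\<close>
  within \<open>d\<close> of \<open>- f\<close>, because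
  \<open>\<Gamma> F \<le> \<Gamma> f \<le> g\<close>. The cost is a factor
  \<open>exp (2 * l * d)\<close>, which disappears as \<open>d\<close> tends to
  \<open>0\<close>.\<close>

lemma mgf_bound_minus:
  assumes sq: "\<And>h. h \<in> \<A> \<Longrightarrow> (\<lambda>x. (h x)\<^sup>2) \<in> \<A> \<and>
      (\<forall>x\<in>space M. \<Gamma> (\<lambda>x. (h x)\<^sup>2) x \<le> 2 * \<bar>h x\<bar> * \<Gamma> h x)"
    and f: "f \<in> \<A>" and g: "g \<in> \<A>" and fg: "\<And>x. x \<in> space M \<Longrightarrow> \<Gamma> f x \<le> g x"
    and b: "0 < b" "\<And>x. x \<in> space M \<Longrightarrow> \<Gamma> g x \<le> b"
    and l: "0 < l" "2 * \<rho> * b * l \<le> 1"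
  shows "expectation (\<lambda>x. exp (l * (expectation f - f x)))
    \<le> exp (2 * \<rho> * l\<^sup>2 * expectation (\<lambda>x. (g x)\<^sup>2))"
proof -
  define v where "v = expectation (\<lambda>x. (g x)\<^sup>2)"
  have bf: "bounded_measurable M f"
    using f by (rule bounded_measurable_mem)
  have "expectation (\<lambda>x. exp (l * (expectation f - f x))) \<le> exp (2 * l * d + 2 * \<rho> * l\<^sup>2 * v)"
    if d: "d > 0" for d
  proof -
    obtain F where F: "F \<in> \<A>" "\<And>x. x \<in> space M \<Longrightarrow> \<Gamma> F x \<le> \<Gamma> f x"
        "\<And>x. x \<in> space M \<Longrightarrow> \<bar>F x + f x\<bar> \<le> d"
      using approx_minus[OF sq f d] by blast
    have bF: "bounded_measurable M F"
      using F(1) by (rule bounded_measurable_mem)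
    have "expectation (\<lambda>x. F x + f x) \<le> d"
      using F(3) bF bf
      by (intro integral_le_const bounded_measurable_integrable bounded_measurable_intros AE_I2) (auto simp: abs_le_iff)
    then have Ef: "expectation F + expectation f \<le> d"
      using bF bf by (simp add: bounded_measurable_integrable)
    have "expectation (\<lambda>x. exp (l * (expectation f - f x)))
        \<le> expectation (\<lambda>x. exp (2 * l * d) * exp (l * (F x - expectation F)))"
    proof (intro integral_mono bounded_measurable_integrable bounded_measurable_intros bf bF)
      fix x assume x: "x \<in> space M"
      \<comment> \<open>One \<open>d\<close> comes from replacing \<open>- f x\<close> by
        \<open>F x\<close>, the other from replacing the mean of \<open>f\<close> by that of
        \<open>- F\<close>.\<close>
      have "expectation f - f x \<le> 2 * d + (F x - expectation F)"
        using Ef F(3)[OF x] by (simp add: abs_le_iff)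
      then have "l * (expectation f - f x) \<le> l * (2 * d + (F x - expectation F))"
        using l by (intro mult_left_mono) auto
      then show "exp (l * (expectation f - f x)) \<le> exp (2 * l * d) * exp (l * (F x - expectation F))"
        by (simp add: exp_add[symmetric] algebra_simps)
    qed
    also have "\<dots> = exp (2 * l * d) * expectation (\<lambda>x. exp (l * (F x - expectation F)))"
      by simp
    also have "\<dots> \<le> exp (2 * l * d) * exp (2 * \<rho> * l\<^sup>2 * v)"
      unfolding v_def
    proof (intro mult_left_mono mgf_bound[OF _ F(1) g _ b l])
      show "\<Gamma> F x \<le> g x" if "x \<in> space M" for x
        using F(2) fg that order_trans by blast
      fix h assume "h \<in> \<A>" and pos: "\<And>x. x \<in> space M \<Longrightarrow> 0 < h x"
      then show "(\<lambda>x. (h x)\<^sup>2) \<in> \<A> \<and> (\<forall>x\<in>space M. \<Gamma> (\<lambda>x. (h x)\<^sup>2) x \<le> 2 * h x * \<Gamma> h x)"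
        using sq[of h] pos by (simp add: abs_of_pos)
    qed simp_all
    finally show ?thesis
      by (simp add: exp_add)
  qed
  moreover have "((\<lambda>d. exp (2 * l * d + 2 * \<rho> * l\<^sup>2 * v)) \<longlongrightarrow> exp (2 * l * 0 + 2 * \<rho> * l\<^sup>2 * v)) (at_right 0)"
    by (intro tendsto_intros)
  ultimately have "expectation (\<lambda>x. exp (l * (expectation f - f x))) \<le> exp (2 * l * 0 + 2 * \<rho> * l\<^sup>2 * v)"
    by (intro tendsto_lowerbound[rotated 1]) (auto simp: eventually_at_filter)
  then show ?thesis
    by (simp add: v_def)
qed

end

section \<open>The two tail bounds\<close>

theorem proposition1p3:
  fixes M :: "'a measure" and \<A> :: "('a \<Rightarrow> real) set"
    and \<Gamma> :: "('a \<Rightarrow> real) \<Rightarrow> 'a \<Rightarrow> real"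
    and \<rho> b :: real and f g :: "'a \<Rightarrow> real"
  assumes "prob_space M"
    and "difference_operator M \<A> \<Gamma>"
    and "0 < \<rho>" and "mLSI M \<A> \<Gamma> \<rho>"
    and "\<And>h. h \<in> \<A> \<Longrightarrow> (\<And>x. x \<in> space M \<Longrightarrow> 0 < h x) \<Longrightarrow>
           (\<lambda>x. (h x)\<^sup>2) \<in> \<A> \<and> (\<forall>x\<in>space M. \<Gamma> (\<lambda>x. (h x)\<^sup>2) x \<le> 2 * h x * \<Gamma> h x)"
    and "f \<in> \<A>" and "g \<in> \<A>"
    and "\<And>x. x \<in> space M \<Longrightarrow> \<Gamma> f x \<le> g x"
    and "0 < b" and "\<And>x. x \<in> space M \<Longrightarrow> \<Gamma> g x \<le> b"
  shows "(\<forall>t\<ge>0. measure M {x \<in> space M. f x - (\<integral>y. f y \<partial>M) \<ge> t}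
            \<le> two_level_bound \<rho> (\<integral>x. (g x)\<^sup>2 \<partial>M) b t) \<and>
         ((\<forall>h\<in>\<A>. (\<lambda>x. (h x)\<^sup>2) \<in> \<A> \<and>
              (\<forall>x\<in>space M. \<Gamma> (\<lambda>x. (h x)\<^sup>2) x \<le> 2 * \<bar>h x\<bar> * \<Gamma> h x)) \<longrightarrow>
          (\<forall>t\<ge>0. measure M {x \<in> space M. (\<integral>y. f y \<partial>M) - f x \<ge> t}
            \<le> two_level_bound \<rho> (\<integral>x. (g x)\<^sup>2 \<partial>M) b t))"
proof -
  interpret mLSI_space M \<A> \<Gamma> \<rho>
    using assms(1,2,4) by (simp add: mLSI_space_def mLSI_space_axioms_def)
  have bf: "bounded_measurable M f"
    using assms(6) by (rule bounded_measurable_mem)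
  have v: "0 \<le> expectation (\<lambda>x. (g x)\<^sup>2)"
    by simp
  \<comment> \<open>Both tails are instances of the same bound, for \<open>f\<close> minus its mean
    and for the negative of that function.\<close>
  note tail = two_level_tail[OF _ v \<open>0 < b\<close> \<open>0 < \<rho>\<close>]
  show ?thesis
  proof (intro conjI impI allI)
    fix t :: real assume "0 \<le> t"
    then show "prob {x \<in> space M. f x - expectation f \<ge> t}
        \<le> two_level_bound \<rho> (expectation (\<lambda>x. (g x)\<^sup>2)) b t"
      using bf by (intro tail bounded_measurable_intros mgf_bound[OF assms(5,6,7,8,9,10)])
  next
    fix t :: real
    assume sq: "\<forall>h\<in>\<A>. (\<lambda>x. (h x)\<^sup>2) \<in> \<A> \<and>
        (\<forall>x\<in>space M. \<Gamma> (\<lambda>x. (h x)\<^sup>2) x \<le> 2 * \<bar>h x\<bar> * \<Gamma> h x)"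
      and "0 \<le> t"
    then show "prob {x \<in> space M. expectation f - f x \<ge> t}
        \<le> two_level_bound \<rho> (expectation (\<lambda>x. (g x)\<^sup>2)) b t"
      using bf by (intro tail bounded_measurable_intros mgf_bound_minus[OF bspec[OF sq] assms(6,7,8,9,10)])
  qed
qed

end
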